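(* For every integer $n\geq 2$, the star $S_n$ with $n$ leaves satisfies \[\psi_{sq}(S_{n})=\beta_{2}(S_{n})=n.\]
   Context: All graphs are finite and simple (undirected, no loops, no multiple edges). For a graph $G=(V,E)$ and $v\in V$, $N_G[v]=\{v\}\cup\{u\in V: uv\in E\}$ is the closed neighborhood of $v$. A sub-quorum coloring of $G$ is an onto partial function $f:V\rightarrow\{1,2,\ldots,\ell\}$ such that for every vertex $v\in V$, if $f(v)$ is defined, then at least half of the vertices of $N_G[v]$ at which $f$ is defined have the same color (value of $f$) as $v$. The sub-quorum coloring number $\psi_{sq}(G)$ is the maximum value of $\ell$ over all sub-quorum colorings of $G$. A set $S\subseteq V$ is a $2$-independent set of $G$ if every vertex of $S$ has at most one neighbor in $S$; the $2$-independence number $\beta_2(G)$ is the maximum cardinality of a $2$-independent set of $G$. The star $S_n$ is the graph on $n+1$ vertices consisting of a center vertex adjacent to $n$ pairwise non-adjacent vertices (its leaves). *)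

theory Defs
  imports "Graph_Theory.Digraph"
begin

text \<open>
  Finite simple undirected graphs are the graphs of the \<^locale>\<open>graph\<close> locale, i.e.\ finite,
  loop-free, symmetric digraphs without parallel arcs; an edge \<open>uv\<close> is the pair of opposite arcs
  \<open>u \<rightarrow>\<^bsub>G\<^esub> v\<close> and \<open>v \<rightarrow>\<^bsub>G\<^esub> u\<close>.
\<close>

definition closed_nbhd :: "('a, 'b) pre_digraph \<Rightarrow> 'a \<Rightarrow> 'a set" where
  "closed_nbhd G v = insert v {u \<in> verts G. u \<rightarrow>\<^bsub>G\<^esub> v}"

text \<open>The empty colouring is allowed and uses \<open>l = 0\<close> colours.\<close>

definition sub_quorum_coloring :: "('a, 'b) pre_digraph \<Rightarrow> nat \<Rightarrow> ('a \<rightharpoonup> nat) \<Rightarrow> bool" where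
  "sub_quorum_coloring G l f \<longleftrightarrow>
     dom f \<subseteq> verts G \<and> ran f = {1..l} \<and>
     (\<forall>v \<in> dom f. real (card {u \<in> closed_nbhd G v \<inter> dom f. f u = f v})
                    \<ge> real (card (closed_nbhd G v \<inter> dom f)) / 2)"

definition sub_quorum_number :: "('a, 'b) pre_digraph \<Rightarrow> nat" where
  "sub_quorum_number G = Max {l. \<exists>f. sub_quorum_coloring G l f}"

definition two_independent :: "('a, 'b) pre_digraph \<Rightarrow> 'a set \<Rightarrow> bool" where
  "two_independent G S \<longleftrightarrow> S \<subseteq> verts G \<and> (\<forall>v \<in> S. card {u \<in> S. u \<rightarrow>\<^bsub>G\<^esub> v} \<le> 1)"

definition two_independence_number :: "('a, 'b) pre_digraph \<Rightarrow> nat" where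
  "two_independence_number G = Max {card S | S. two_independent G S}"

text \<open>
  Stars are characterised up to isomorphism: \<open>c\<close> is the centre and \<open>L\<close> the set of leaves.
\<close>

definition is_star :: "('a, 'b) pre_digraph \<Rightarrow> nat \<Rightarrow> bool" where
  "is_star G n \<longleftrightarrow> graph G \<and>
     (\<exists>c L. c \<notin> L \<and> finite L \<and> card L = n \<and> verts G = insert c L \<and>
        (\<forall>u v. u \<rightarrow>\<^bsub>G\<^esub> v \<longleftrightarrow> u = c \<and> v \<in> L \<or> u \<in> L \<and> v = c))"

text \<open>
  The sets of which \<^const>\<open>Max\<close> is taken are finite and nonempty on finite graphs, and stars
  of every size exist.
\<close>

lemma finite_sub_quorum:
  assumes "graph G"
  shows "finite {l. \<exists>f. sub_quorum_coloring G l f}"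
proof (rule finite_subset)
  interpret graph G by fact
  show "{l. \<exists>f. sub_quorum_coloring G l f} \<subseteq> {..card (verts G)}"
  proof clarsimp
    fix l f assume "sub_quorum_coloring G l f"
    then have d: "dom f \<subseteq> verts G" and r: "ran f = {1..l}"
      by (auto simp: sub_quorum_coloring_def)
    have "ran f = (\<lambda>x. the (f x)) ` dom f"
      by (force simp: ran_def dom_def image_def)
    then have "card (ran f) \<le> card (dom f)"
      using card_image_le finite_subset[OF d] by (metis finite_verts)
    also have "\<dots> \<le> card (verts G)"
      using d by (simp add: card_mono)
    finally show "l \<le> card (verts G)" using r by simp
  qed
qed simp

lemma sub_quorum_empty: "sub_quorum_coloring G 0 Map.empty"
  by (simp add: sub_quorum_coloring_def)

lemma finite_two_independent:
  assumes "graph G"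
  shows "finite {card S | S. two_independent G S}"
proof -
  interpret graph G by fact
  have "finite (card ` Pow (verts G))" by simp
  then show ?thesis
    by (rule rev_finite_subset) (auto simp: two_independent_def)
qed

lemma two_independent_empty: "two_independent G {}"
  by (simp add: two_independent_def)

lemma is_star_exists: "\<exists>G :: (nat, nat \<times> nat) pre_digraph. is_star G n"
proof
  let ?G = "\<lparr>verts = {..n}, arcs = {0} \<times> {1..n} \<union> {1..n} \<times> {0}, tail = fst, head = snd\<rparr>"
  have adj: "u \<rightarrow>\<^bsub>?G\<^esub> v \<longleftrightarrow> u = 0 \<and> v \<in> {1..n} \<or> u \<in> {1..n} \<and> v = 0" for u v :: nat
    by (auto simp: arcs_ends_def arc_to_ends_def image_def)
  have "graph ?G"
    by unfold_locales
      (auto simp: arc_to_ends_def arcs_ends_def symmetric_def sym_def image_def)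
  moreover have "{..n} = insert 0 {1..n}" by auto
  ultimately show "is_star ?G n"
    unfolding is_star_def using adj
    by (intro conjI exI[of _ "0::nat"] exI[of _ "{1..n}"]) simp_all
qed

end

theory Submission
  imports Defs
begin

text \<open>
  Both extremal objects live on the leaves: they form a 2-independent set, and giving them distinct
  colours while leaving the centre uncoloured is a sub-quorum colouring. Conversely \<open>n + 1\<close> colours
  (or a 2-independent set of size \<open>n + 1\<close>) would use every vertex, with pairwise distinct colours, and
  both conditions then fail at the centre, which has \<open>n \<ge> 2\<close> neighbours.
\<close>

text \<open>Colours are counted as an image of the coloured vertices, so cardinality facts about
  images apply to \<open>ran f\<close>.\<close>

lemma ran_eq_image_the: "ran f = (\<lambda>x. the (f x)) ` dom f"
  by (force simp: ran_def dom_def image_def)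

lemma closed_nbhd_center:
  assumes "verts G = insert c L"
    and "\<And>u v. u \<rightarrow>\<^bsub>G\<^esub> v \<longleftrightarrow> u = c \<and> v \<in> L \<or> u \<in> L \<and> v = c"
  shows "closed_nbhd G c = insert c L"
  using assms by (auto simp: closed_nbhd_def)

lemma closed_nbhd_leaf:
  assumes "verts G = insert c L" "c \<notin> L" "v \<in> L"
    and "\<And>u v. u \<rightarrow>\<^bsub>G\<^esub> v \<longleftrightarrow> u = c \<and> v \<in> L \<or> u \<in> L \<and> v = c"
  shows "closed_nbhd G v = {v, c}"
  using assms by (auto simp: closed_nbhd_def)

lemma sub_quorum_number_star:
  assumes "n \<ge> 2" and "is_star G n"
  shows "sub_quorum_number G = n"
proof -
  from assms obtain c L where g: "graph G" and cL: "c \<notin> L" and fin: "finite L"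
    and n: "card L = n" and V: "verts G = insert c L"
    and adj: "\<And>u v. u \<rightarrow>\<^bsub>G\<^esub> v \<longleftrightarrow> u = c \<and> v \<in> L \<or> u \<in> L \<and> v = c"
    unfolding is_star_def by blast
  have "l \<le> n" if col: "sub_quorum_coloring G l f" for l f
  proof (rule ccontr)
    assume "\<not> l \<le> n"
    have dom: "dom f \<subseteq> insert c L" and ran: "ran f = {1..l}"
      using col V by (auto simp: sub_quorum_coloring_def)
    have fd: "finite (dom f)" using dom fin finite_subset by blast
    have le: "card (dom f) \<le> Suc n" using card_mono[OF _ dom] fin cL n by simp
    have im: "card ((\<lambda>x. the (f x)) ` dom f) = l"
      using ran by (simp flip: ran_eq_image_the)
    with card_image_le[OF fd] have "l \<le> card (dom f)" by metis
    with le \<open>\<not> l \<le> n\<close> have l: "card (dom f) = Suc n" "l = Suc n" by auto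
    then have domV: "dom f = insert c L"
      using card_subset_eq[OF _ dom] fin cL n by simp
    \<comment> \<open>There are as many colours as coloured vertices, and a map from a finite set
      onto a set of equal size is injective.\<close>
    have inj: "inj_on (\<lambda>x. the (f x)) (dom f)"
      using fd im l by (simp add: eq_card_imp_inj_on)
    \<comment> \<open>All vertices being coloured, the whole closed neighbourhood of
      \<open>c\<close> counts. By injectivity only \<open>c\<close> has its own colour, so the
      quorum condition reads 1 \<ge> (n + 1) / 2, which fails once n \<ge> 2.\<close>
    have "real (card {u \<in> insert c L. f u = f c}) \<ge> real (card (insert c L)) / 2"
      using col domV closed_nbhd_center[OF V adj]
      by (auto simp: sub_quorum_coloring_def)
    moreover have "{u \<in> insert c L. f u = f c} = {c}"
      using inj domV by (auto simp: inj_on_def)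
    ultimately show False using assms(1) cL fin n by simp
  qed
  moreover have "\<exists>f. sub_quorum_coloring G n f"
  proof -
    \<comment> \<open>The range must be exactly \<open>{1..n}\<close>, so the leaves are numbered by
      a bijection.\<close>
    obtain h where h: "bij_betw h L {1..n}"
      using fin n by (metis finite_same_card_bij finite_atLeastAtMost card_atLeastAtMost diff_Suc_1)
    let ?f = "\<lambda>v. if v \<in> L then Some (h v) else None"
    have dom: "dom ?f = L" by (auto simp: dom_def)
    have "ran ?f = h ` L" by (auto simp: ran_def)
    then have ran: "ran ?f = {1..n}" using h by (simp add: bij_betw_def)
    \<comment> \<open>The only neighbour of a leaf is the uncoloured centre, so the quorum condition
      at a leaf is 1 \<ge> 1 / 2.\<close>
    have "{u \<in> closed_nbhd G v \<inter> L. ?f u = ?f v} = {v}" "closed_nbhd G v \<inter> L = {v}"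
      if "v \<in> L" for v
      using closed_nbhd_leaf[OF V cL that adj] that cL by auto
    then have "sub_quorum_coloring G n ?f"
      unfolding sub_quorum_coloring_def dom using V ran by auto
    then show ?thesis by blast
  qed
  ultimately show ?thesis
    unfolding sub_quorum_number_def
    by (intro Max_eqI finite_sub_quorum[OF g]) auto
qed

lemma two_independence_number_star:
  assumes "n \<ge> 2" and "is_star G n"
  shows "two_independence_number G = n"
proof -
  from assms obtain c L where g: "graph G" and cL: "c \<notin> L" and fin: "finite L"
    and n: "card L = n" and V: "verts G = insert c L"
    and adj: "\<And>u v. u \<rightarrow>\<^bsub>G\<^esub> v \<longleftrightarrow> u = c \<and> v \<in> L \<or> u \<in> L \<and> v = c"
    unfolding is_star_def by blast
  have "card S \<le> n" if S: "two_independent G S" for S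
  proof (rule ccontr)
    assume "\<not> card S \<le> n"
    have sub: "S \<subseteq> insert c L" using S V by (simp add: two_independent_def)
    then have "S = insert c L"
      using card_seteq[OF _ sub] \<open>\<not> card S \<le> n\<close> fin cL n by simp
    \<comment> \<open>Since \<open>c\<close> is not its own neighbour, its neighbours in
      \<open>S\<close> are exactly the n \<ge> 2 leaves, against the bound of 1.\<close>
    moreover from this have "{u \<in> S. u \<rightarrow>\<^bsub>G\<^esub> c} = L" using cL adj by auto
    ultimately have "card L \<le> 1" using S unfolding two_independent_def by auto
    with assms(1) n show False by simp
  qed
  moreover have "two_independent G L"
  proof -
    have "card {u \<in> L. u \<rightarrow>\<^bsub>G\<^esub> v} \<le> 1" if "v \<in> L" for v
    proof -
      \<comment> \<open>Leaves are pairwise non-adjacent, so \<open>L\<close> is even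
        independent.\<close>
      have "{u \<in> L. u \<rightarrow>\<^bsub>G\<^esub> v} = {}" using that cL adj by auto
      then show ?thesis by (metis card.empty zero_le)
    qed
    then show ?thesis unfolding two_independent_def using V by blast
  qed
  ultimately show ?thesis
    unfolding two_independence_number_def using n
    by (intro Max_eqI finite_two_independent[OF g]) auto
qed

theorem proposition14:
  fixes G :: "('a, 'b) pre_digraph" and n :: nat
  assumes "n \<ge> 2" and "is_star G n"
  shows "sub_quorum_number G = two_independence_number G \<and> two_independence_number G = n"
  using assms by (simp add: sub_quorum_number_star two_independence_number_star)

end
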